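(* Let $n$ be a positive integer. If $\varphi$ is an elliptic linear fractional self-map of $\mathbb{D}$ other than the identity and with Denjoy-Wolff point $p$, then the map $\widehat{\varphi}=\varphi_p\circ\varphi\circ\varphi_p$ has the form $\widehat{\varphi}(z)=\dfrac{Az}{Cz+1}$ with $|A|+|C|\le1$ and $A\neq1$. The number of solutions $f$ (among the self-maps of $\mathbb{D}$) of the equation $f_n=\varphi$ equals the cardinality of the set $$\{a\in\mathbb{C}: a^n=A\ \text{ and }\ |C(1-a)|\le(1-|a|)\cdot|1-A|\}.$$ Furthermore, each solution of the equation $f_n=\varphi$ is determined by one such root $a$ and is again an elliptic linear fractional transformation of the form $f=\varphi_p\circ g\circ\varphi_p$, where $$g(z)=\frac{az}{\frac{C(1-a)}{1-A}z+1}.$$ In particular, if $\varphi$ is an elliptic automorphism other than the identity, there are exactly $n$ different solutions of the equation $f_n=\varphi$.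
   Context: $\mathbb{D}$ is the open unit disk in $\mathbb{C}$. A self-map of $\mathbb{D}$ is a function analytic in $\mathbb{D}$ with $f(\mathbb{D})\subset\mathbb{D}$; $f_n$ denotes its $n$-th iterate: $f_1=f$, $f_{n+1}=f\circ f_n$. A linear fractional self-map of $\mathbb{D}$ is a self-map of the form $z\mapsto (az+b)/(cz+d)$ with $ad-bc\ne0$. An automorphism is a bijective self-map of $\mathbb{D}$. A non-identity self-map of $\mathbb{D}$ is elliptic if it has a (necessarily unique) fixed point in $\mathbb{D}$; this point is called its Denjoy-Wolff point (also when the map is an automorphism). For $p\in\mathbb{D}$, $\varphi_p(z)=\dfrac{p-z}{1-\overline{p}z}$, an involutive disk automorphism interchanging $p$ and $0$. *)

theory Defs
  imports "HOL-Complex_Analysis.Complex_Analysis"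
begin

abbreviation unit_disk :: "complex set" where
  "unit_disk \<equiv> ball 0 1"

(* Self-maps of the disk are represented by total functions; only their values on the
   disk matter in the predicates below. *)

definition disk_self_map :: "(complex \<Rightarrow> complex) \<Rightarrow> bool" where
  "disk_self_map f \<longleftrightarrow> f holomorphic_on unit_disk \<and> f ` unit_disk \<subseteq> unit_disk"

definition disk_automorphism :: "(complex \<Rightarrow> complex) \<Rightarrow> bool" where
  "disk_automorphism f \<longleftrightarrow> disk_self_map f \<and> bij_betw f unit_disk unit_disk"

definition linear_fractional_self_map :: "(complex \<Rightarrow> complex) \<Rightarrow> bool" where
  "linear_fractional_self_map f \<longleftrightarrow> disk_self_map f \<and>
     (\<exists>a b c d. a * d - b * c \<noteq> 0 \<and>
       (\<forall>z\<in>unit_disk. c * z + d \<noteq> 0 \<and> f z = (a * z + b) / (c * z + d)))"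

definition elliptic :: "(complex \<Rightarrow> complex) \<Rightarrow> bool" where
  "elliptic f \<longleftrightarrow> disk_self_map f \<and> (\<exists>z\<in>unit_disk. f z \<noteq> z) \<and> (\<exists>p\<in>unit_disk. f p = p)"

(* The Denjoy-Wolff point, for elliptic maps only; a relation, since the fixed point of an
   elliptic map in the disk is unique. *)
definition elliptic_denjoy_wolff_point :: "(complex \<Rightarrow> complex) \<Rightarrow> complex \<Rightarrow> bool" where
  "elliptic_denjoy_wolff_point f p \<longleftrightarrow> elliptic f \<and> p \<in> unit_disk \<and> f p = p"

definition disk_involution :: "complex \<Rightarrow> complex \<Rightarrow> complex" where
  "disk_involution p z = (p - z) / (1 - cnj p * z)"

(* Solutions are functions on the disk, so that counting them must not distinguish total
   functions that agree on the disk; membership in "extensional" fixes the values outside. *)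
definition iterative_roots :: "nat \<Rightarrow> (complex \<Rightarrow> complex) \<Rightarrow> (complex \<Rightarrow> complex) set" where
  "iterative_roots n \<phi> =
     {f \<in> extensional unit_disk. disk_self_map f \<and> (\<forall>z\<in>unit_disk. (f ^^ n) z = \<phi> z)}"

definition admissible_roots :: "nat \<Rightarrow> complex \<Rightarrow> complex \<Rightarrow> complex set" where
  "admissible_roots n A C =
     {a. a ^ n = A \<and> cmod (C * (1 - a)) \<le> (1 - cmod a) * cmod (1 - A)}"

definition root_map :: "complex \<Rightarrow> complex \<Rightarrow> complex \<Rightarrow> complex \<Rightarrow> complex" where
  "root_map A C a z = a * z / (C * (1 - a) / (1 - A) * z + 1)"

end

theory Submission
  imports Defs
begin

text \<open>Conjugating by the involution that exchanges \<open>p\<close> and \<open>0\<close> reduces everything to a map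
  \<open>\<psi> z = A * z / (C * z + 1)\<close> fixing the origin. Such a map keeps the disk invariant exactly when
  \<open>\<bar>A\<bar> + \<bar>C\<bar> \<le> 1\<close>. With \<open>c = C / (1 - A)\<close>, the function \<open>\<sigma> z = z / (c * z + 1)\<close> is injective on the
  disk and satisfies \<open>\<sigma> (\<psi> z) = A * \<sigma> z\<close>; it is the Koenigs function of \<open>\<psi>\<close>, in closed form. Solving
  \<open>\<sigma> w = a * \<sigma> z\<close> for \<open>w\<close> gives precisely the map \<open>root_map A C a\<close> of the theorem, and these maps
  form a semigroup in which multipliers multiply. So an \<open>a\<close> with \<open>a ^ n = A\<close> yields an \<open>n\<close>-th root
  as soon as \<open>root_map A C a\<close> preserves the disk, and this, by the criterion above applied to
  \<open>a\<close> and \<open>C * (1 - a) / (1 - A)\<close>, is the inequality that defines \<open>admissible_roots\<close>.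

  What remains is that every root \<open>g\<close> arises in this way, that is, \<open>\<sigma> (g z) = a * \<sigma> z\<close> for some \<open>a\<close>.
  A root commutes with \<open>\<psi>\<close>, so it fixes the only fixed point \<open>0\<close> of \<open>\<psi>\<close>. If \<open>\<bar>A\<bar> < 1\<close>, the quotient
  \<open>\<sigma> (g z) / \<sigma> z\<close> is constant along the orbits of \<open>\<psi>\<close>, which converge to \<open>0\<close>, and hence
  equals its limit \<open>g' 0\<close> there (\<open>root_linearized_of_attracting\<close>). If \<open>\<bar>A\<bar> = 1\<close>, then
  \<open>\<psi>\<close> is a rotation and the equality case of the Schwarz lemma makes \<open>g\<close> a rotation as well
  (\<open>root_linearized_of_rotation\<close>). The two cases meet in \<open>root_is_root_map\<close>.

  An elliptic automorphism is conjugate to a rotation \<open>z \<mapsto> A * z\<close>, again by the Schwarz lemma. Then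
  \<open>C = 0\<close> and every \<open>n\<close>-th root of \<open>A\<close> lies on the unit circle and is admissible.\<close>

section \<open>Linear fractional self-maps of the disk\<close>

lemma disk_self_mapD:
  assumes "disk_self_map f" "z \<in> unit_disk"
  shows "f z \<in> unit_disk"
  using assms unfolding disk_self_map_def by blast

lemma disk_self_map_cong:
  assumes "\<And>z. z \<in> unit_disk \<Longrightarrow> f z = g z"
  shows "disk_self_map f \<longleftrightarrow> disk_self_map g"
  unfolding disk_self_map_def
  using assms holomorphic_cong[OF refl, of unit_disk f g] by (metis (no_types, lifting) image_cong)

lemma linear_fractional_self_map_cong:
  assumes "\<And>z. z \<in> unit_disk \<Longrightarrow> f z = g z"
  shows "linear_fractional_self_map f \<longleftrightarrow> linear_fractional_self_map g"
  unfolding linear_fractional_self_map_def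
  using disk_self_map_cong[OF assms] assms by simp

lemma disk_self_map_compose:
  assumes "disk_self_map f" "disk_self_map g"
  shows "disk_self_map (f \<circ> g)"
  using assms holomorphic_on_compose_gen[of g unit_disk f unit_disk]
  unfolding disk_self_map_def by (auto simp: image_subset_iff)

lemma funpow_in_disk:
  assumes "disk_self_map f" "z \<in> unit_disk"
  shows "(f ^^ n) z \<in> unit_disk"
  by (induction n) (use assms disk_self_mapD in auto)

lemma linear_fractional_self_map_compose:
  assumes "linear_fractional_self_map f" "linear_fractional_self_map g"
  shows "linear_fractional_self_map (f \<circ> g)"
proof -
  obtain a b c d where f: "a * d - b * c \<noteq> 0"
      "\<And>z. z \<in> unit_disk \<Longrightarrow> c * z + d \<noteq> 0 \<and> f z = (a * z + b) / (c * z + d)"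
    using assms(1) unfolding linear_fractional_self_map_def by blast
  obtain a' b' c' d' where g: "a' * d' - b' * c' \<noteq> 0"
      "\<And>z. z \<in> unit_disk \<Longrightarrow> c' * z + d' \<noteq> 0 \<and> g z = (a' * z + b') / (c' * z + d')"
    using assms(2) unfolding linear_fractional_self_map_def by blast
  let ?a = "a * a' + b * c'" and ?b = "a * b' + b * d'"
    and ?c = "c * a' + d * c'" and ?d = "c * b' + d * d'"
  have "?a * ?d - ?b * ?c = (a * d - b * c) * (a' * d' - b' * c')"
    by (simp add: algebra_simps)
  then have "?a * ?d - ?b * ?c \<noteq> 0"
    using f(1) g(1) by simp
  moreover have "?c * z + ?d \<noteq> 0 \<and> (f \<circ> g) z = (?a * z + ?b) / (?c * z + ?d)"
    if z: "z \<in> unit_disk" for z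
  proof -
    have gz: "g z \<in> unit_disk"
      using assms(2) z disk_self_mapD by (auto simp: linear_fractional_self_map_def)
    have nz: "c' * z + d' \<noteq> 0" and geq: "g z * (c' * z + d') = a' * z + b'"
      using g(2)[OF z] by auto
    have num: "?a * z + ?b = (a * g z + b) * (c' * z + d')"
      using arg_cong[OF geq, of "\<lambda>w. a * w"] by (simp add: algebra_simps)
    have den: "?c * z + ?d = (c * g z + d) * (c' * z + d')"
      using arg_cong[OF geq, of "\<lambda>w. c * w"] by (simp add: algebra_simps)
    show ?thesis
      unfolding num den using f(2)[OF gz] nz by simp
  qed
  moreover have "disk_self_map (f \<circ> g)"
    using assms disk_self_map_compose by (simp add: linear_fractional_self_map_def)
  ultimately show ?thesis
    unfolding linear_fractional_self_map_def by blast
qed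

lemma affine_denominator_nonzero:
  fixes C :: complex
  assumes "cmod C \<le> 1" "z \<in> unit_disk"
  shows "C * z + 1 \<noteq> 0"
proof
  assume "C * z + 1 = 0"
  then have "cmod C * cmod z = 1"
    by (metis add_eq_0_iff norm_minus_cancel norm_mult norm_one)
  moreover have "cmod C * cmod z \<le> cmod z"
    using assms by (simp add: mult_left_le_one_le)
  ultimately show False
    using assms by simp
qed

lemma fixing_0_denominator_nonzero:
  fixes A C :: complex
  assumes "cmod A + cmod C \<le> 1" "z \<in> unit_disk"
  shows "C * z + 1 \<noteq> 0"
proof (rule affine_denominator_nonzero[OF _ assms(2)])
  show "cmod C \<le> 1"
    using assms(1) norm_ge_zero[of A] by linarith
qed

lemma disk_self_map_fixing_0I:
  assumes "cmod A + cmod C \<le> 1"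
  shows "disk_self_map (\<lambda>z. A * z / (C * z + 1))"
  unfolding disk_self_map_def
proof
  have nz: "C * z + 1 \<noteq> 0" if "z \<in> unit_disk" for z
    by (rule fixing_0_denominator_nonzero[OF assms that])
  show "(\<lambda>z. A * z / (C * z + 1)) holomorphic_on unit_disk"
    using nz by (auto intro!: holomorphic_intros)
  show "(\<lambda>z. A * z / (C * z + 1)) ` unit_disk \<subseteq> unit_disk"
  proof safe
    fix z :: complex assume z: "z \<in> unit_disk"
    have "(cmod A + cmod C) * cmod z \<le> 1 * cmod z"
      using assms by (intro mult_right_mono) auto
    also have "1 * cmod z < 1"
      using z by simp
    finally have "cmod (A * z) < 1 - cmod (C * z)"
      by (simp add: norm_mult algebra_simps)
    also have "\<dots> \<le> cmod (C * z + 1)"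
      using norm_diff_ineq[of 1 "C * z"] by (simp add: add.commute)
    finally show "A * z / (C * z + 1) \<in> unit_disk"
      using nz[OF z] by (simp add: norm_divide divide_less_eq)
  qed
qed

text \<open>The bound is read off along the radius on which \<open>C * z\<close> is real and negative: there the
  denominator has modulus \<open>1 - cmod C * cmod z\<close>, as small as it can be.\<close>

lemma disk_self_map_fixing_0D:
  assumes nz: "\<And>z. z \<in> unit_disk \<Longrightarrow> C * z + 1 \<noteq> 0"
    and self: "disk_self_map (\<lambda>z. A * z / (C * z + 1))"
  shows "cmod A + cmod C \<le> 1"
proof -
  have C1: "cmod C \<le> 1"
  proof (rule ccontr)
    assume "\<not> cmod C \<le> 1"
    then have "- (1 / C) \<in> unit_disk" "C * (- (1 / C)) + 1 = 0"
      by (auto simp: norm_divide divide_less_eq not_le)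
    then show False
      using nz by blast
  qed
  obtain u where u: "cmod u = 1" "C * u = - complex_of_real (cmod C)"
  proof (cases "C = 0")
    case True
    then show ?thesis using that[of 1] by simp
  next
    case False
    show ?thesis
      by (rule that[of "- complex_of_real (cmod C) / C"]) (use False in \<open>auto simp: norm_divide\<close>)
  qed
  have radius: "(cmod A + cmod C) * r < 1" if r: "0 < r" "r < 1" for r :: real
  proof -
    let ?z = "complex_of_real r * u"
    have z: "?z \<in> unit_disk"
      using r u by (simp add: norm_mult)
    have "C * ?z + 1 = complex_of_real (1 - cmod C * r)"
      using arg_cong[OF u(2), of "\<lambda>w. complex_of_real r * w"] by (simp add: algebra_simps)
    moreover have "0 < 1 - cmod C * r"
      using mult_right_mono[OF C1, of r] r by linarith
    ultimately have den: "cmod (C * ?z + 1) = 1 - cmod C * r"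
      by (metis abs_of_pos norm_of_real)
    have "cmod (A * ?z / (C * ?z + 1)) < 1"
      using disk_self_mapD[OF self z] by simp
    then have "cmod (A * ?z) < cmod (C * ?z + 1)"
      using nz[OF z] by (simp add: norm_divide divide_less_eq)
    then show ?thesis
      using den r u(1) by (simp add: norm_mult algebra_simps)
  qed
  show ?thesis
  proof (rule ccontr)
    assume gt: "\<not> cmod A + cmod C \<le> 1"
    then show False
      using radius[of "1 / (cmod A + cmod C)"] by auto
  qed
qed

lemma linear_fractional_self_map_fixing_0I:
  assumes "A \<noteq> 0" "cmod A + cmod C \<le> 1"
  shows "linear_fractional_self_map (\<lambda>z. A * z / (C * z + 1))"
proof -
  have "C * z + 1 \<noteq> 0" if "z \<in> unit_disk" for z
    by (rule fixing_0_denominator_nonzero[OF assms(2) that])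
  then show ?thesis
    unfolding linear_fractional_self_map_def
    using disk_self_map_fixing_0I[OF assms(2)] assms(1)
    by (intro conjI exI[of _ A] exI[of _ 0] exI[of _ C] exI[of _ 1]) auto
qed

text \<open>Fixing \<open>0\<close> forces the numerator to have no constant term, and the denominator, which does not
  vanish at \<open>0\<close>, can be normalized to have constant term \<open>1\<close>.\<close>

lemma linear_fractional_self_map_fixing_0E:
  assumes "linear_fractional_self_map g" "g 0 = 0"
  obtains A C where "A \<noteq> 0" "cmod A + cmod C \<le> 1"
    "\<And>z. z \<in> unit_disk \<Longrightarrow> g z = A * z / (C * z + 1)"
proof -
  obtain a b c d where det: "a * d - b * c \<noteq> 0" and
    lf: "\<And>z. z \<in> unit_disk \<Longrightarrow> c * z + d \<noteq> 0 \<and> g z = (a * z + b) / (c * z + d)"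
    using assms(1) unfolding linear_fractional_self_map_def by blast
  have d: "d \<noteq> 0" and b: "b = 0"
    using lf[of 0] assms(2) by auto
  have den: "c * z + d = d * (c / d * z + 1)" for z
    using d by (simp add: field_simps)
  have nz: "c / d * z + 1 \<noteq> 0" and g: "g z = a / d * z / (c / d * z + 1)"
    if "z \<in> unit_disk" for z
    using lf[OF that] d b unfolding den by auto
  have "disk_self_map (\<lambda>z. a / d * z / (c / d * z + 1))"
    using disk_self_map_cong[of g, OF g] assms(1) by (simp add: linear_fractional_self_map_def)
  then have "cmod (a / d) + cmod (c / d) \<le> 1"
    using disk_self_map_fixing_0D nz by blast
  then show ?thesis
    using that[of "a / d" "c / d"] det b d g by auto
qed

text \<open>After clearing denominators, the two sides divided by \<open>z\<close> are affine in \<open>z\<close>, so two nonzero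
  points determine the coefficients. The denominator \<open>C' * z + 1\<close> could a priori vanish in the
  disk, but there the quotient would be \<open>0\<close>, a value that the left-hand side takes only at the
  origin.\<close>

lemma fixing_0_coefficients_unique:
  fixes A C A' C' :: complex
  assumes "A \<noteq> 0" "cmod A + cmod C \<le> 1"
    and eq: "\<And>z. z \<in> unit_disk \<Longrightarrow> A * z / (C * z + 1) = A' * z / (C' * z + 1)"
  shows "A' = A" "C' = C"
proof -
  have cross: "A * (C' * z + 1) = A' * (C * z + 1)" if z: "z \<in> unit_disk" "z \<noteq> 0" for z
  proof -
    have "C * z + 1 \<noteq> 0"
      by (rule fixing_0_denominator_nonzero[OF assms(2) z(1)])
    moreover from this have "C' * z + 1 \<noteq> 0"
      using eq[OF z(1)] z(2) assms(1) by auto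
    ultimately have "z * (A * (C' * z + 1)) = z * (A' * (C * z + 1))"
      using eq[OF z(1)] by (simp add: field_simps)
    then show ?thesis
      using z(2) by simp
  qed
  have "A * (C' * (1 / 2) + 1) = A' * (C * (1 / 2) + 1)"
       "A * (C' * (- (1 / 2)) + 1) = A' * (C * (- (1 / 2)) + 1)"
    by (intro cross; simp add: norm_divide)+
  then have "A * C' = A' * C" "A = A'"
    by algebra+
  then show "A' = A" "C' = C"
    using assms(1) by auto
qed

lemma schwarz_norm_le:
  assumes "disk_self_map g" "g 0 = 0" "z \<in> unit_disk"
  shows "cmod (g z) \<le> cmod z"
proof (rule Schwarz_Lemma(1))
  show "g holomorphic_on ball 0 1"
    using assms(1) by (simp add: disk_self_map_def)
  show "\<And>w. cmod w < 1 \<Longrightarrow> cmod (g w) < 1"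
    using disk_self_mapD[OF assms(1)] by simp
qed (use assms in auto)

text \<open>The equality case of the Schwarz lemma, from a one-sided inequality at a single point.\<close>

lemma schwarz_rotation:
  assumes g: "disk_self_map g" "g 0 = 0"
    and z: "z \<in> unit_disk" "z \<noteq> 0" "cmod z \<le> cmod (g z)"
  obtains a where "cmod a = 1" "\<And>w. w \<in> unit_disk \<Longrightarrow> g w = a * w"
proof -
  have eq: "cmod (g z) = cmod z"
    using schwarz_norm_le[OF g z(1)] z(3) by simp
  have "\<exists>\<alpha>. (\<forall>z. norm z < 1 \<longrightarrow> g z = \<alpha> * z) \<and> norm \<alpha> = 1"
  proof (rule Schwarz_Lemma(3)[of g 0])
    show "g holomorphic_on ball 0 1"
      using g(1) by (simp add: disk_self_map_def)
    show "\<And>z. cmod z < 1 \<Longrightarrow> cmod (g z) < 1"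
      using disk_self_mapD[OF g(1)] by simp
    show "(\<exists>z. cmod z < 1 \<and> z \<noteq> 0 \<and> cmod (g z) = cmod z) \<or> cmod (deriv g 0) = 1"
      using eq z by (intro disjI1 exI[of _ z]) auto
  qed (use g in auto)
  then show ?thesis
    using that by auto
qed

lemma funpow_norm_le:
  assumes g: "disk_self_map g" "g 0 = 0" and z: "z \<in> unit_disk"
  shows "cmod ((g ^^ k) z) \<le> cmod z"
proof (induction k)
  case (Suc k)
  then show ?case
    using schwarz_norm_le[OF g funpow_in_disk[OF g(1) z, of k]] by simp
qed simp

section \<open>The involution and conjugation by it\<close>

lemma disk_involution_eq_Moebius: "disk_involution p z = - Moebius_function 0 p z"
  unfolding disk_involution_def Moebius_function_simple
  by (metis minus_diff_eq minus_divide_left)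

lemma disk_involution_denominator_nonzero:
  assumes "p \<in> unit_disk" "z \<in> unit_disk"
  shows "1 - cnj p * z \<noteq> 0"
  using affine_denominator_nonzero[of "- cnj p" z] assms by simp

lemma linear_fractional_disk_involution:
  assumes p: "p \<in> unit_disk"
  shows "linear_fractional_self_map (disk_involution p)"
proof -
  have "disk_self_map (disk_involution p)"
    unfolding disk_self_map_def
  proof
    show "disk_involution p holomorphic_on unit_disk"
      unfolding disk_involution_def
      using disk_involution_denominator_nonzero[OF p] by (auto intro!: holomorphic_intros)
    show "disk_involution p ` unit_disk \<subseteq> unit_disk"
      using p Moebius_function_norm_lt_1 by (auto simp: disk_involution_eq_Moebius)
  qed
  moreover have "(- 1) * 1 - p * (- cnj p) \<noteq> 0"
    using disk_involution_denominator_nonzero[OF p p] by (simp add: mult.commute)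
  moreover have "- cnj p * z + 1 \<noteq> 0 \<and> disk_involution p z = (- 1 * z + p) / (- cnj p * z + 1)"
    if "z \<in> unit_disk" for z
    using disk_involution_denominator_nonzero[OF p that]
    by (simp add: disk_involution_def)
  ultimately show ?thesis
    unfolding linear_fractional_self_map_def by blast
qed

lemma disk_self_map_disk_involution:
  "p \<in> unit_disk \<Longrightarrow> disk_self_map (disk_involution p)"
  using linear_fractional_disk_involution by (simp add: linear_fractional_self_map_def)

lemma disk_involution_at_0 [simp]: "disk_involution p 0 = p"
  and disk_involution_at_self [simp]: "disk_involution p p = 0"
  by (simp_all add: disk_involution_def)

lemma disk_involution_involutive:
  assumes "p \<in> unit_disk" "z \<in> unit_disk"
  shows "disk_involution p (disk_involution p z) = z"
proof -
  have nz: "1 - cnj p * z \<noteq> 0" "1 - cnj p * p \<noteq> 0"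
    using disk_involution_denominator_nonzero assms by auto
  define d where "d = 1 - cnj p * z"
  have w: "disk_involution p z = (p - z) / d"
    by (simp add: disk_involution_def d_def)
  have "p - (p - z) / d = z * (1 - cnj p * p) / d"
    using nz by (simp add: d_def field_simps)
  moreover have "1 - cnj p * ((p - z) / d) = (1 - cnj p * p) / d"
    using nz by (simp add: d_def field_simps)
  ultimately show ?thesis
    unfolding w by (simp add: disk_involution_def nz) (use nz d_def in auto)
qed

text \<open>Because the involution is its own inverse on the disk, conjugation by it is also an involution
  and commutes with iteration; it therefore carries the iterative roots of a map to those
  of its conjugate.\<close>

abbreviation involution_conjugate :: "complex \<Rightarrow> (complex \<Rightarrow> complex) \<Rightarrow> complex \<Rightarrow> complex" where
  "involution_conjugate p f \<equiv> disk_involution p \<circ> f \<circ> disk_involution p"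

lemma disk_self_map_conjugate:
  assumes "p \<in> unit_disk" "disk_self_map f"
  shows "disk_self_map (involution_conjugate p f)"
  by (intro disk_self_map_compose disk_self_map_disk_involution assms)

lemma linear_fractional_self_map_conjugate:
  assumes "p \<in> unit_disk" "linear_fractional_self_map f"
  shows "linear_fractional_self_map (involution_conjugate p f)"
  by (intro linear_fractional_self_map_compose linear_fractional_disk_involution assms)

lemma conjugate_conjugate:
  assumes "p \<in> unit_disk" "disk_self_map f" "z \<in> unit_disk"
  shows "involution_conjugate p (involution_conjugate p f) z = f z"
  using assms disk_self_mapD[OF assms(2,3)]
  by (simp add: disk_involution_involutive)

lemma conjugate_cong:
  assumes "p \<in> unit_disk" "z \<in> unit_disk" "\<And>w. w \<in> unit_disk \<Longrightarrow> f w = g w"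
  shows "involution_conjugate p f z = involution_conjugate p g z"
  using assms(3)[OF disk_self_mapD[OF disk_self_map_disk_involution[OF assms(1)] assms(2)]]
  by simp

lemma funpow_conjugate:
  assumes p: "p \<in> unit_disk" and f: "disk_self_map f" and z: "z \<in> unit_disk"
  shows "(involution_conjugate p f ^^ n) z = involution_conjugate p (f ^^ n) z"
proof (induction n)
  case 0
  then show ?case
    using disk_involution_involutive[OF p z] by simp
next
  case (Suc n)
  have "(f ^^ n) (disk_involution p z) \<in> unit_disk"
    using funpow_in_disk[OF f] disk_self_mapD[OF disk_self_map_disk_involution[OF p] z] by blast
  then show ?case
    using Suc disk_involution_involutive[OF p] by simp
qed

lemma funpow_cong_on_disk:
  assumes "disk_self_map f" "\<And>w. w \<in> unit_disk \<Longrightarrow> f w = g w" "z \<in> unit_disk"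
  shows "(f ^^ n) z = (g ^^ n) z"
proof (induction n)
  case (Suc n)
  have "(g ^^ n) z \<in> unit_disk"
    using funpow_in_disk[OF assms(1,3), of n] Suc by simp
  then show ?case
    using Suc assms(2) by simp
qed simp

section \<open>Iterative roots fixing the origin\<close>

text \<open>In the coordinate \<open>1 / z\<close> the map \<open>A * z / (C * z + 1)\<close> becomes the affine map
  \<open>w \<mapsto> (w + C) / A\<close>, with fixed point \<open>- C / (1 - A)\<close>. Moving that fixed point to \<open>0\<close> and inverting
  again gives \<open>koenigs_map (C / (1 - A))\<close>, in whose coordinate the map is multiplication by \<open>A\<close>.\<close>

definition koenigs_map :: "complex \<Rightarrow> complex \<Rightarrow> complex" where
  "koenigs_map c z = z / (c * z + 1)"

lemma koenigs_map_0 [simp]: "koenigs_map c 0 = 0"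
  by (simp add: koenigs_map_def)

lemma koenigs_map_inj_on_disk:
  assumes "cmod c \<le> 1" "w \<in> unit_disk" "z \<in> unit_disk" "koenigs_map c w = koenigs_map c z"
  shows "w = z"
proof -
  have "w * (c * z + 1) = z * (c * w + 1)"
    using assms affine_denominator_nonzero[OF assms(1)]
    by (simp add: koenigs_map_def frac_eq_eq)
  then show ?thesis
    by (simp add: algebra_simps)
qed

locale fractional_map_fixing_0 =
  fixes A C :: complex
  assumes A0: "A \<noteq> 0" and A1: "A \<noteq> 1" and bound: "cmod A + cmod C \<le> 1"
begin

abbreviation (input) "\<sigma> \<equiv> koenigs_map (C / (1 - A))"

text \<open>The pole of \<open>\<sigma>\<close> corresponds to the second fixed point \<open>- (1 - A) / C\<close> of the map, which the
  bound on the coefficients keeps out of the open disk.\<close>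

lemma pole_bound: "cmod (C / (1 - A)) \<le> 1"
proof -
  have "cmod C \<le> cmod (1 - A)"
    using bound norm_triangle_ineq2[of 1 A] by simp
  then show ?thesis
    using A1 by (simp add: norm_divide)
qed

lemmas denominator_nonzero = affine_denominator_nonzero[OF pole_bound]

lemmas \<sigma>_inj = koenigs_map_inj_on_disk[OF pole_bound]

lemma \<sigma>_eq_0_iff: "z \<in> unit_disk \<Longrightarrow> \<sigma> z = 0 \<longleftrightarrow> z = 0"
  using denominator_nonzero by (simp add: koenigs_map_def)

text \<open>The map itself is the member of the family \<open>root_map A C\<close> with multiplier \<open>A\<close>, so the facts
  about the family apply to it too.\<close>

lemma root_map_multiplier: "root_map A C A z = A * z / (C * z + 1)"
  using A1 by (simp add: root_map_def)

lemma admissible_roots_iff: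
  "a \<in> admissible_roots n A C \<longleftrightarrow> a ^ n = A \<and> cmod a + cmod (C * (1 - a) / (1 - A)) \<le> 1"
proof -
  have "cmod (1 - A) > 0"
    using A1 by simp
  then have "cmod (C * (1 - a)) \<le> (1 - cmod a) * cmod (1 - A) \<longleftrightarrow>
      cmod (C * (1 - a)) / cmod (1 - A) \<le> 1 - cmod a"
    by (simp add: pos_divide_le_eq)
  then show ?thesis
    unfolding admissible_roots_def norm_divide by auto
qed

lemma \<sigma>_root_map:
  assumes "cmod a + cmod (C * (1 - a) / (1 - A)) \<le> 1" and z: "z \<in> unit_disk"
  shows "\<sigma> (root_map A C a z) = a * \<sigma> z"
proof -
  define c where "c = C / (1 - A)"
  define e where "e = C * (1 - a) / (1 - A)"
  have "e = c * (1 - a)"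
    by (simp add: c_def e_def)
  then have ce: "c * a + e = c"
    by (simp add: algebra_simps)
  have nz: "e * z + 1 \<noteq> 0"
    unfolding e_def by (rule fixing_0_denominator_nonzero[OF assms])
  have "c * (a * z / (e * z + 1)) + 1 = (c * z + 1) / (e * z + 1)"
    using nz ce by (simp add: field_simps) (metis distrib_left mult.commute mult.left_commute)
  then show ?thesis
    using nz unfolding koenigs_map_def root_map_def c_def[symmetric] e_def[symmetric] by simp
qed

text \<open>Solving \<open>\<sigma> w = a * \<sigma> z\<close> for \<open>w\<close> also shows that the denominator of the solution is nonzero:
  if it vanished, then \<open>a * z = 0\<close>, and the denominator would be that of \<open>\<sigma> z\<close>. The coefficient
  bound on \<open>a\<close> can then be deduced instead of assumed.\<close>

lemma root_map_eqI:
  assumes w: "w \<in> unit_disk" and z: "z \<in> unit_disk" and eq: "\<sigma> w = a * \<sigma> z"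
  shows "w = root_map A C a z" "C * (1 - a) / (1 - A) * z + 1 \<noteq> 0"
proof -
  define c where "c = C / (1 - A)"
  define e where "e = C * (1 - a) / (1 - A)"
  have ce: "e = c - c * a"
    by (simp add: c_def e_def diff_divide_distrib algebra_simps)
  have nz: "c * w + 1 \<noteq> 0" "c * z + 1 \<noteq> 0"
    using denominator_nonzero w z by (auto simp: c_def)
  have "w * (c * z + 1) = a * z * (c * w + 1)"
    using eq nz unfolding koenigs_map_def c_def[symmetric] by (simp add: field_simps)
  then have *: "w * (e * z + 1) = a * z"
    by (simp add: ce algebra_simps)
  have "e * z + 1 \<noteq> 0"
  proof
    assume 0: "e * z + 1 = 0"
    then have "a * z = 0"
      using * by simp
    then show False
      using 0 nz by (auto simp: ce)
  qed
  with * show "w = root_map A C a z" "C * (1 - a) / (1 - A) * z + 1 \<noteq> 0"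
    unfolding root_map_def e_def[symmetric] by (simp_all add: field_simps)
qed

lemma disk_self_map_root_map:
  "cmod a + cmod (C * (1 - a) / (1 - A)) \<le> 1 \<Longrightarrow> disk_self_map (root_map A C a)"
  unfolding root_map_def by (rule disk_self_map_fixing_0I)

lemma \<sigma>_funpow:
  assumes "disk_self_map g" "\<And>z. z \<in> unit_disk \<Longrightarrow> \<sigma> (g z) = a * \<sigma> z" "z \<in> unit_disk"
  shows "\<sigma> ((g ^^ k) z) = a ^ k * \<sigma> z"
proof (induction k)
  case (Suc k)
  then show ?case
    using assms(2)[OF funpow_in_disk[OF assms(1,3), of k]] by simp
qed simp

abbreviation (input) "\<psi> \<equiv> root_map A C A"

lemma \<psi>_bound: "cmod A + cmod (C * (1 - A) / (1 - A)) \<le> 1"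
  using bound A1 by simp

lemmas \<psi>_self_map = disk_self_map_root_map[OF \<psi>_bound]
lemmas \<sigma>_\<psi> = \<sigma>_root_map[OF \<psi>_bound]

lemma \<psi>_fixed_point:
  assumes "z \<in> unit_disk" "\<psi> z = z"
  shows "z = 0"
proof -
  have "\<sigma> z = A * \<sigma> z"
    using \<sigma>_\<psi>[OF assms(1)] assms(2) by simp
  then have "(1 - A) * \<sigma> z = 0"
    by (simp add: algebra_simps)
  then show ?thesis
    using A1 \<sigma>_eq_0_iff[OF assms(1)] by simp
qed

lemma funpow_root_map:
  assumes a: "a \<in> admissible_roots n A C" and z: "z \<in> unit_disk"
  shows "(root_map A C a ^^ n) z = \<psi> z"
proof (rule \<sigma>_inj)
  have a': "a ^ n = A" "cmod a + cmod (C * (1 - a) / (1 - A)) \<le> 1"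
    using a by (auto simp: admissible_roots_iff)
  show "(root_map A C a ^^ n) z \<in> unit_disk"
    by (intro funpow_in_disk disk_self_map_root_map a' z)
  show "\<psi> z \<in> unit_disk"
    by (rule disk_self_mapD[OF \<psi>_self_map z])
  show "\<sigma> ((root_map A C a ^^ n) z) = \<sigma> (\<psi> z)"
    using \<sigma>_funpow[OF disk_self_map_root_map[OF a'(2)] \<sigma>_root_map[OF a'(2)] z] \<sigma>_\<psi>[OF z] a'(1)
    by simp
qed

lemma root_map_inj:
  assumes "a \<in> admissible_roots n A C" "b \<in> admissible_roots n A C"
    and "\<And>z. z \<in> unit_disk \<Longrightarrow> root_map A C a z = root_map A C b z"
  shows "a = b"
proof -
  have z: "1 / 2 \<in> unit_disk"
    by (simp add: norm_divide)
  have "a * \<sigma> (1 / 2) = b * \<sigma> (1 / 2)"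
    using \<sigma>_root_map[OF _ z] assms(1,2) assms(3)[OF z] by (metis admissible_roots_iff)
  then show ?thesis
    using \<sigma>_eq_0_iff[OF z] by simp
qed

text \<open>The map \<open>g\<close> commutes with its iterate \<open>\<psi>\<close>, so \<open>g 0\<close> is a fixed point of \<open>\<psi>\<close>.\<close>

lemma root_fixes_0:
  assumes g: "disk_self_map g" and root: "\<And>z. z \<in> unit_disk \<Longrightarrow> (g ^^ n) z = \<psi> z"
  shows "g 0 = 0"
proof (rule \<psi>_fixed_point)
  show g0: "g 0 \<in> unit_disk"
    using disk_self_mapD[OF g] by simp
  have "(g ^^ n) 0 = 0"
    using root[of 0] by (simp add: root_map_def)
  then have "(g ^^ n) (g 0) = g 0"
    by (metis funpow_swap1)
  then show "\<psi> (g 0) = g 0"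
    using root[OF g0] by simp
qed

text \<open>In the coordinate \<open>\<sigma>\<close> the orbit is geometric, and the inverse \<open>s / (1 - c * s)\<close> of \<open>\<sigma>\<close> is
  continuous at \<open>0\<close>.\<close>

lemma funpow_\<psi>_tendsto_0:
  assumes "cmod A < 1" and z: "z \<in> unit_disk"
  shows "(\<lambda>k. (\<psi> ^^ k) z) \<longlonglongrightarrow> 0"
proof -
  define c where "c = C / (1 - A)"
  have inv: "w = \<sigma> w / (1 - c * \<sigma> w)" if "w \<in> unit_disk" for w
  proof -
    have "1 - c * \<sigma> w = 1 / (c * w + 1)"
      using denominator_nonzero[OF that] unfolding koenigs_map_def c_def[symmetric]
      by (simp add: field_simps)
    then show ?thesis
      using denominator_nonzero[OF that] unfolding koenigs_map_def c_def[symmetric] by simp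
  qed
  have "(\<lambda>k. A ^ k * \<sigma> z) \<longlonglongrightarrow> 0 * \<sigma> z"
    by (intro tendsto_intros LIMSEQ_power_zero assms(1))
  then have "(\<lambda>k. \<sigma> ((\<psi> ^^ k) z)) \<longlonglongrightarrow> 0"
    using \<sigma>_funpow[OF \<psi>_self_map \<sigma>_\<psi> z] by simp
  then have "(\<lambda>k. \<sigma> ((\<psi> ^^ k) z) / (1 - c * \<sigma> ((\<psi> ^^ k) z))) \<longlonglongrightarrow> 0 / (1 - c * 0)"
    by (intro tendsto_intros) auto
  moreover have "\<sigma> ((\<psi> ^^ k) z) / (1 - c * \<sigma> ((\<psi> ^^ k) z)) = (\<psi> ^^ k) z" for k
    using inv[OF funpow_in_disk[OF \<psi>_self_map z]] by simp
  ultimately show ?thesis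
    by simp
qed

text \<open>The quotient \<open>q w = \<sigma> (g w) / \<sigma> w\<close> is unchanged when \<open>w\<close> is replaced by \<open>\<psi> w\<close>, since \<open>g\<close> commutes
  with \<open>\<psi>\<close> and \<open>\<psi>\<close> multiplies both numerator and denominator by \<open>A\<close>. As \<open>\<sigma>\<close> is tangent to the
  identity at \<open>0\<close>, \<open>q\<close> has the limit \<open>deriv g 0\<close> there, and the orbits of \<open>\<psi>\<close> tend to \<open>0\<close>.\<close>

lemma root_linearized_of_attracting:
  assumes A: "cmod A < 1" and g: "disk_self_map g" "g 0 = 0"
    and commute: "\<And>z. z \<in> unit_disk \<Longrightarrow> g (\<psi> z) = \<psi> (g z)"
    and z: "z \<in> unit_disk"
  shows "\<sigma> (g z) = deriv g 0 * \<sigma> z"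
proof (cases "z = 0")
  case True
  then show ?thesis using g by simp
next
  case False
  define c where "c = C / (1 - A)"
  define q where "q w = \<sigma> (g w) / \<sigma> w" for w
  have orbit: "(\<psi> ^^ k) z \<in> unit_disk" for k
    by (rule funpow_in_disk[OF \<psi>_self_map z])
  have \<sigma>_orbit: "\<sigma> ((\<psi> ^^ k) z) = A ^ k * \<sigma> z" for k
    by (rule \<sigma>_funpow[OF \<psi>_self_map \<sigma>_\<psi> z])
  have \<sigma>z: "\<sigma> z \<noteq> 0"
    using False \<sigma>_eq_0_iff[OF z] by simp
  \<comment> \<open>the limit of \<open>q\<close> at \<open>0\<close> is taken over the punctured neighbourhood, which the orbit must not leave\<close>
  have nonzero: "(\<psi> ^^ k) z \<noteq> 0" for k
    using \<sigma>_orbit[of k] \<sigma>z A0 by (metis koenigs_map_0 mult_eq_0_iff power_not_zero)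
  have "g ((\<psi> ^^ k) z) = (\<psi> ^^ k) (g z)" for k
    by (induction k) (use commute orbit in auto)
  then have q_orbit: "q ((\<psi> ^^ k) z) = q z" for k
    using \<sigma>_funpow[OF \<psi>_self_map \<sigma>_\<psi> disk_self_mapD[OF g(1) z]] \<sigma>_orbit A0
    by (simp add: q_def)
  have "g holomorphic_on unit_disk"
    using g(1) by (simp add: disk_self_map_def)
  then have dg: "(g has_field_derivative deriv g 0) (at 0)"
    by (rule holomorphic_derivI) auto
  then have slope: "((\<lambda>w. g w / w) \<longlongrightarrow> deriv g 0) (at 0)"
    using g(2) by (simp add: has_field_derivative_iff)
  have cont: "(g \<longlongrightarrow> 0) (at 0)"
    using DERIV_isCont[OF dg] g(2) by (simp add: isCont_def)
  have "((\<lambda>w. g w / w * ((c * w + 1) / (c * g w + 1))) \<longlongrightarrow>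
      deriv g 0 * ((c * 0 + 1) / (c * 0 + 1))) (at 0)"
    by (intro tendsto_intros slope cont) auto
  moreover have "g w / w * ((c * w + 1) / (c * g w + 1)) = q w" for w
    by (simp add: q_def koenigs_map_def c_def)
  ultimately have lim: "(q \<longlongrightarrow> deriv g 0) (at 0)"
    by simp
  have "filterlim (\<lambda>k. (\<psi> ^^ k) z) (at 0) sequentially"
    using funpow_\<psi>_tendsto_0[OF A z] nonzero by (simp add: filterlim_at)
  then have "(\<lambda>k. q ((\<psi> ^^ k) z)) \<longlonglongrightarrow> deriv g 0"
    by (rule filterlim_compose[OF lim])
  then have "q z = deriv g 0"
    unfolding q_orbit by (simp add: LIMSEQ_const_iff)
  then show ?thesis
    using \<sigma>z by (simp add: q_def field_simps)
qed

text \<open>When \<open>A\<close> is a root of unity, commuting with the rotation does not force \<open>g\<close> to be linear, so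
  the iteration itself is used: \<open>g\<close> does not increase the modulus, and its \<open>n\<close>-th iterate preserves
  it, so \<open>g\<close> preserves it too.\<close>

lemma root_linearized_of_rotation:
  assumes n: "n > 0" and A: "cmod A = 1" and g: "disk_self_map g" "g 0 = 0"
    and root: "\<And>z. z \<in> unit_disk \<Longrightarrow> (g ^^ n) z = \<psi> z"
  obtains a where "\<And>z. z \<in> unit_disk \<Longrightarrow> \<sigma> (g z) = a * \<sigma> z"
proof -
  have C: "C = 0"
    using bound A by simp
  have z: "1 / 2 \<in> unit_disk"
    by (simp add: norm_divide)
  obtain m where m: "n = Suc m"
    using n gr0_implies_Suc by blast
  have "cmod (1 / 2) = cmod ((g ^^ n) (1 / 2))"
    unfolding root[OF z] using A C by (simp add: root_map_def norm_mult norm_divide)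
  also have "\<dots> = cmod ((g ^^ m) (g (1 / 2)))"
    by (simp add: m funpow_swap1)
  also have "\<dots> \<le> cmod (g (1 / 2))"
    by (rule funpow_norm_le[OF g disk_self_mapD[OF g(1) z]])
  finally have "cmod (1 / 2) \<le> cmod (g (1 / 2))" .
  then obtain a where "\<And>w. w \<in> unit_disk \<Longrightarrow> g w = a * w"
    using schwarz_rotation[OF g z] by auto
  then show ?thesis
    using that C by (auto simp: koenigs_map_def)
qed

text \<open>Once \<open>g\<close> is linear in the coordinate \<open>\<sigma>\<close>, iterating gives \<open>a ^ n = A\<close>, and the
  inequality holds because \<open>g\<close> maps the disk into itself.\<close>

theorem root_is_root_map:
  assumes n: "n > 0" and g: "disk_self_map g"
    and root: "\<And>z. z \<in> unit_disk \<Longrightarrow> (g ^^ n) z = \<psi> z"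
  obtains a where "a \<in> admissible_roots n A C" "\<And>z. z \<in> unit_disk \<Longrightarrow> g z = root_map A C a z"
proof -
  have g0: "g 0 = 0"
    by (rule root_fixes_0[OF g root])
  obtain a where a: "\<And>z. z \<in> unit_disk \<Longrightarrow> \<sigma> (g z) = a * \<sigma> z"
  proof (cases "cmod A = 1")
    case True
    then show ?thesis
      using root_linearized_of_rotation[OF n True g g0 root] that by blast
  next
    case False
    then have "cmod A < 1"
      using bound norm_ge_zero[of C] by linarith
    moreover have "g (\<psi> z) = \<psi> (g z)" if "z \<in> unit_disk" for z
      using root[OF that] root[OF disk_self_mapD[OF g that]] by (metis funpow_swap1)
    ultimately show ?thesis
      using root_linearized_of_attracting[OF _ g g0] that by blast
  qed
  have z: "1 / 2 \<in> unit_disk"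
    by (simp add: norm_divide)
  have "a ^ n * \<sigma> (1 / 2) = A * \<sigma> (1 / 2)"
    using \<sigma>_funpow[OF g a z, of n] root[OF z] \<sigma>_\<psi>[OF z] by metis
  then have an: "a ^ n = A"
    using \<sigma>_eq_0_iff[OF z] by auto
  have g_eq: "g z = root_map A C a z" and nz: "C * (1 - a) / (1 - A) * z + 1 \<noteq> 0"
    if "z \<in> unit_disk" for z
    using root_map_eqI[OF disk_self_mapD[OF g that] that a[OF that]] by blast+
  have "disk_self_map (\<lambda>z. a * z / (C * (1 - a) / (1 - A) * z + 1))"
    using disk_self_map_cong[of g, OF g_eq] g by (simp add: root_map_def[abs_def])
  then have "cmod a + cmod (C * (1 - a) / (1 - A)) \<le> 1"
    using disk_self_map_fixing_0D nz by blast
  then show ?thesis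
    using that an g_eq by (auto simp: admissible_roots_iff)
qed

end

section \<open>Transport to an arbitrary fixed point\<close>

lemma iterative_roots_eq_image:
  assumes n: "n > 0" and p: "p \<in> unit_disk" and \<phi>: "disk_self_map \<phi>"
    and A: "A \<noteq> 0" "A \<noteq> 1" "cmod A + cmod C \<le> 1"
    and normal: "\<And>z. z \<in> unit_disk \<Longrightarrow> involution_conjugate p \<phi> z = A * z / (C * z + 1)"
  shows "iterative_roots n \<phi> =
    (\<lambda>a. restrict (involution_conjugate p (root_map A C a)) unit_disk) ` admissible_roots n A C"
    (is "?R = ?F ` ?S")
proof -
  interpret fractional_map_fixing_0 A C
    using A by unfold_locales
  have normal': "involution_conjugate p \<phi> z = root_map A C A z" if "z \<in> unit_disk" for z
    using normal[OF that] by (simp only: root_map_multiplier)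
  have "f \<in> ?F ` ?S" if f: "f \<in> ?R" for f
  proof -
    have f': "f \<in> extensional unit_disk" "disk_self_map f"
      "\<And>z. z \<in> unit_disk \<Longrightarrow> (f ^^ n) z = \<phi> z"
      using f by (auto simp: iterative_roots_def)
    have "(involution_conjugate p f ^^ n) z = root_map A C A z" if z: "z \<in> unit_disk" for z
      unfolding funpow_conjugate[OF p f'(2) z] normal'[OF z, symmetric]
      by (rule conjugate_cong[OF p z f'(3)])
    then obtain a where a: "a \<in> ?S"
        "\<And>z. z \<in> unit_disk \<Longrightarrow> involution_conjugate p f z = root_map A C a z"
      using root_is_root_map[OF n disk_self_map_conjugate[OF p f'(2)]] by blast
    have "f z = ?F a z" for z
    proof (cases "z \<in> unit_disk")
      case True
      have "involution_conjugate p (involution_conjugate p f) z =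
          involution_conjugate p (root_map A C a) z"
        by (rule conjugate_cong[OF p True]) (rule a(2))
      then show ?thesis
        unfolding restrict_apply'[OF True] conjugate_conjugate[OF p f'(2) True] .
    next
      case False
      then show ?thesis
        using f'(1) by (simp add: extensional_def)
    qed
    then show ?thesis
      using a(1) by blast
  qed
  moreover have "?F a \<in> ?R" if a: "a \<in> ?S" for a
  proof -
    have self: "disk_self_map (root_map A C a)"
      using a disk_self_map_root_map by (simp add: admissible_roots_iff)
    have self': "disk_self_map (involution_conjugate p (root_map A C a))"
      by (rule disk_self_map_conjugate[OF p self])
    have "(?F a ^^ n) z = \<phi> z" if z: "z \<in> unit_disk" for z
    proof -
      have "(?F a ^^ n) z = (involution_conjugate p (root_map A C a) ^^ n) z"
        by (rule sym, rule funpow_cong_on_disk[OF self' _ z]) simp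
      also have "\<dots> = involution_conjugate p (root_map A C a ^^ n) z"
        by (rule funpow_conjugate[OF p self z])
      also have "\<dots> = involution_conjugate p (involution_conjugate p \<phi>) z"
        by (rule conjugate_cong[OF p z]) (use funpow_root_map[OF a] normal' in auto)
      also have "\<dots> = \<phi> z"
        by (rule conjugate_conjugate[OF p \<phi> z])
      finally show ?thesis .
    qed
    moreover have "disk_self_map (?F a)"
      using disk_self_map_cong[of "?F a" "involution_conjugate p (root_map A C a)"] self' by simp
    ultimately show ?thesis
      by (simp add: iterative_roots_def)
  qed
  ultimately show ?thesis
    by blast
qed

lemma inj_on_conjugate_root_map:
  assumes p: "p \<in> unit_disk" and A: "A \<noteq> 0" "A \<noteq> 1" "cmod A + cmod C \<le> 1"
  shows "inj_on (\<lambda>a. restrict (involution_conjugate p (root_map A C a)) unit_disk)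
    (admissible_roots n A C)" (is "inj_on ?F _")
proof (rule inj_onI)
  interpret fractional_map_fixing_0 A C
    using A by unfold_locales
  fix a b assume ab: "a \<in> admissible_roots n A C" "b \<in> admissible_roots n A C"
    and eq: "?F a = ?F b"
  have self: "disk_self_map (root_map A C a)" "disk_self_map (root_map A C b)"
    using ab disk_self_map_root_map by (auto simp: admissible_roots_iff)
  show "a = b"
  proof (rule root_map_inj[OF ab])
    fix z :: complex assume z: "z \<in> unit_disk"
    have "involution_conjugate p (root_map A C a) w = involution_conjugate p (root_map A C b) w"
      if "w \<in> unit_disk" for w
      using fun_cong[OF eq, of w] that by simp
    then have "involution_conjugate p (involution_conjugate p (root_map A C a)) z =
        involution_conjugate p (involution_conjugate p (root_map A C b)) z"
      by (rule conjugate_cong[OF p z])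
    then show "root_map A C a z = root_map A C b z"
      unfolding conjugate_conjugate[OF p self(1) z] conjugate_conjugate[OF p self(2) z] .
  qed
qed

lemma finite_admissible_roots:
  assumes "n > 0"
  shows "finite (admissible_roots n A C)"
  by (rule finite_subset[OF _ finite_nth_roots[OF assms, of A]]) (auto simp: admissible_roots_def)

text \<open>A root of a map other than the identity is not the identity either.\<close>

lemma elliptic_iterative_root:
  assumes p: "p \<in> unit_disk" and \<phi>: "elliptic \<phi>" and f: "f \<in> iterative_roots n \<phi>" "f p = p"
  shows "elliptic f"
proof -
  have root: "(f ^^ n) z = \<phi> z" if "z \<in> unit_disk" for z
    using f that by (auto simp: iterative_roots_def)
  obtain z where z: "z \<in> unit_disk" "\<phi> z \<noteq> z"
    using \<phi> by (auto simp: elliptic_def)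
  have "f z \<noteq> z"
  proof
    assume "f z = z"
    then have "(f ^^ n) z = z"
      by (induction n) auto
    then show False
      using root z by simp
  qed
  then show ?thesis
    using f p z(1) unfolding elliptic_def iterative_roots_def by auto
qed

text \<open>If \<open>A = 1\<close>, the coefficient bound leaves only \<open>C = 0\<close>, and the map would be the identity.\<close>

lemma elliptic_normal_form:
  assumes \<phi>: "elliptic_denjoy_wolff_point \<phi> p" and lf: "linear_fractional_self_map \<phi>"
  obtains A C where "A \<noteq> 0" "A \<noteq> 1" "cmod A + cmod C \<le> 1"
    "\<And>z. z \<in> unit_disk \<Longrightarrow> involution_conjugate p \<phi> z = A * z / (C * z + 1)"
proof -
  have p: "p \<in> unit_disk" "\<phi> p = p" and self: "disk_self_map \<phi>"
    using \<phi> by (auto simp: elliptic_denjoy_wolff_point_def elliptic_def)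
  have "involution_conjugate p \<phi> 0 = 0"
    using p by simp
  then obtain A C where AC: "A \<noteq> 0" "cmod A + cmod C \<le> 1"
      "\<And>z. z \<in> unit_disk \<Longrightarrow> involution_conjugate p \<phi> z = A * z / (C * z + 1)"
    using linear_fractional_self_map_fixing_0E linear_fractional_self_map_conjugate[OF p(1) lf]
    by blast
  have "A \<noteq> 1"
  proof
    assume "A = 1"
    then have "C = 0"
      using AC(2) by simp
    then have "involution_conjugate p \<phi> z = id z" if "z \<in> unit_disk" for z
      using AC(3)[OF that] \<open>A = 1\<close> by simp
    then have "involution_conjugate p (involution_conjugate p \<phi>) z = involution_conjugate p id z"
      if "z \<in> unit_disk" for z
      by (rule conjugate_cong[OF p(1) that])
    then have "\<phi> z = z" if "z \<in> unit_disk" for z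
      using that conjugate_conjugate[OF p(1) self that] disk_involution_involutive[OF p(1) that]
      by (metis comp_id comp_apply)
    then show False
      using \<phi> by (auto simp: elliptic_denjoy_wolff_point_def elliptic_def)
  qed
  then show ?thesis
    using that AC by blast
qed

lemma disk_automorphism_inverse:
  assumes "disk_automorphism f"
  obtains h where "disk_self_map h" "\<And>z. z \<in> unit_disk \<Longrightarrow> h (f z) = z"
proof -
  have f: "f holomorphic_on unit_disk" "inj_on f unit_disk" "f ` unit_disk = unit_disk"
    using assms by (auto simp: disk_automorphism_def disk_self_map_def bij_betw_def)
  obtain h where h: "h holomorphic_on f ` unit_disk" "\<And>z. z \<in> unit_disk \<Longrightarrow> h (f z) = z"
    using holomorphic_has_inverse[OF f(1) open_ball f(2)] by metis
  moreover have "h ` unit_disk \<subseteq> unit_disk"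
    using h(2) f(3) by (metis (no_types, lifting) image_subset_iff imageE)
  ultimately show ?thesis
    using that f(3) by (auto simp: disk_self_map_def)
qed

text \<open>Neither the conjugated automorphism nor its inverse increases the modulus, so both preserve it.\<close>

lemma automorphism_conjugate_rotation:
  assumes p: "p \<in> unit_disk" and \<phi>: "disk_automorphism \<phi>" "\<phi> p = p"
  obtains A where "cmod A = 1" "\<And>z. z \<in> unit_disk \<Longrightarrow> involution_conjugate p \<phi> z = A * z"
proof -
  have self: "disk_self_map \<phi>"
    using \<phi>(1) by (simp add: disk_automorphism_def)
  obtain h where h: "disk_self_map h" "\<And>z. z \<in> unit_disk \<Longrightarrow> h (\<phi> z) = z"
    using disk_automorphism_inverse[OF \<phi>(1)] by blast
  define g where "g = involution_conjugate p \<phi>"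
  define k where "k = involution_conjugate p h"
  have g: "disk_self_map g" "g 0 = 0"
    using disk_self_map_conjugate[OF p self] \<phi>(2) by (auto simp: g_def)
  have k: "disk_self_map k" "k 0 = 0"
    using disk_self_map_conjugate[OF p h(1)] h(2)[OF p] \<phi>(2) by (auto simp: k_def)
  have kg: "k (g z) = z" if z: "z \<in> unit_disk" for z
  proof -
    have Jz: "disk_involution p z \<in> unit_disk"
      using disk_self_mapD[OF disk_self_map_disk_involution[OF p] z] .
    show ?thesis
      using disk_involution_involutive[OF p disk_self_mapD[OF self Jz]] h(2)[OF Jz]
        disk_involution_involutive[OF p z] by (simp add: g_def k_def)
  qed
  have z: "1 / 2 \<in> unit_disk"
    by (simp add: norm_divide)
  have "cmod (1 / 2) \<le> cmod (g (1 / 2))"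
    using schwarz_norm_le[OF k disk_self_mapD[OF g(1) z]] kg[OF z] by simp
  then obtain A where "cmod A = 1" "\<And>w. w \<in> unit_disk \<Longrightarrow> g w = A * w"
    using schwarz_rotation[OF g z] by auto
  then show ?thesis
    using that unfolding g_def by blast
qed

text \<open>Since \<open>\<bar>a\<bar> = 1\<close> and \<open>C = 0\<close>, both sides of the defining inequality are \<open>0\<close>.\<close>

lemma admissible_roots_rotation:
  assumes "cmod A = 1" "n > 0"
  shows "admissible_roots n A 0 = {a. a ^ n = A}"
proof -
  have "cmod a = 1" if "a ^ n = A" for a
  proof (rule power_eq_imp_eq_base)
    show "cmod a ^ n = 1 ^ n"
      using assms(1) unfolding that[symmetric] by (simp add: norm_power)
  qed (use assms in auto)
  then show ?thesis
    by (auto simp: admissible_roots_def)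
qed

theorem theorem10:
  fixes n :: nat and \<phi> :: "complex \<Rightarrow> complex" and p :: complex
  assumes "n > 0"
    and "elliptic_denjoy_wolff_point \<phi> p"
  shows
    "(linear_fractional_self_map \<phi> \<longrightarrow>
       (\<exists>A C. (\<forall>z\<in>unit_disk.
            (disk_involution p \<circ> \<phi> \<circ> disk_involution p) z = A * z / (C * z + 1)) \<and>
          cmod A + cmod C \<le> 1 \<and> A \<noteq> 1) \<and>
       (\<forall>A C. (\<forall>z\<in>unit_disk.
            (disk_involution p \<circ> \<phi> \<circ> disk_involution p) z = A * z / (C * z + 1)) \<longrightarrow>
          finite (iterative_roots n \<phi>) \<and> finite (admissible_roots n A C) \<and>
          card (iterative_roots n \<phi>) = card (admissible_roots n A C) \<and>
          (\<forall>f\<in>iterative_roots n \<phi>. linear_fractional_self_map f \<and> elliptic f \<and>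
            (\<exists>!a. a \<in> admissible_roots n A C \<and>
              (\<forall>z\<in>unit_disk.
                f z = (disk_involution p \<circ> root_map A C a \<circ> disk_involution p) z))))) \<and>
     (disk_automorphism \<phi> \<longrightarrow> card (iterative_roots n \<phi>) = n)"
proof -
  have p: "p \<in> unit_disk" "\<phi> p = p" and self: "disk_self_map \<phi>" and ell: "elliptic \<phi>"
    using assms(2) by (auto simp: elliptic_denjoy_wolff_point_def elliptic_def)

  have count: "finite (iterative_roots n \<phi>) \<and> finite (admissible_roots n A C) \<and>
      card (iterative_roots n \<phi>) = card (admissible_roots n A C)"
    and describe: "\<forall>f\<in>iterative_roots n \<phi>. linear_fractional_self_map f \<and> elliptic f \<and>
      (\<exists>!a. a \<in> admissible_roots n A C \<and>
        (\<forall>z\<in>unit_disk. f z = involution_conjugate p (root_map A C a) z))"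
    if lf: "linear_fractional_self_map \<phi>"
      and normal: "\<forall>z\<in>unit_disk. involution_conjugate p \<phi> z = A * z / (C * z + 1)" for A C
  proof -
    obtain A' C' where AC': "A' \<noteq> 0" "A' \<noteq> 1" "cmod A' + cmod C' \<le> 1"
        "\<And>z. z \<in> unit_disk \<Longrightarrow> involution_conjugate p \<phi> z = A' * z / (C' * z + 1)"
      using elliptic_normal_form[OF assms(2) lf] by blast
    \<comment> \<open>the given coefficients are the ones of the normal form, so they satisfy its bounds\<close>
    have "A' * z / (C' * z + 1) = A * z / (C * z + 1)" if "z \<in> unit_disk" for z
      using AC'(4)[OF that] normal that by metis
    from fixing_0_coefficients_unique[OF AC'(1,3) this] have "A = A'" "C = C'"
      by blast+
    then have AC: "A \<noteq> 0" "A \<noteq> 1" "cmod A + cmod C \<le> 1"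
      using AC' by auto
    interpret fractional_map_fixing_0 A C
      using AC by unfold_locales
    let ?F = "\<lambda>a. restrict (involution_conjugate p (root_map A C a)) unit_disk"
    have image: "iterative_roots n \<phi> = ?F ` admissible_roots n A C"
      using iterative_roots_eq_image[OF assms(1) p(1) self AC] normal by blast
    have inj: "inj_on ?F (admissible_roots n A C)"
      by (rule inj_on_conjugate_root_map[OF p(1) AC])
    show "finite (iterative_roots n \<phi>) \<and> finite (admissible_roots n A C) \<and>
        card (iterative_roots n \<phi>) = card (admissible_roots n A C)"
      using finite_admissible_roots[OF assms(1)] card_image[OF inj] by (simp add: image)
    show "\<forall>f\<in>iterative_roots n \<phi>. linear_fractional_self_map f \<and> elliptic f \<and>
      (\<exists>!a. a \<in> admissible_roots n A C \<and>
        (\<forall>z\<in>unit_disk. f z = involution_conjugate p (root_map A C a) z))"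
    proof
      fix f assume f: "f \<in> iterative_roots n \<phi>"
      then obtain a where a: "a \<in> admissible_roots n A C" "f = ?F a"
        using image by blast
      have f_eq: "\<forall>z\<in>unit_disk. f z = involution_conjugate p (root_map A C a) z"
        using a(2) by simp
      have a': "a \<noteq> 0" "cmod a + cmod (C * (1 - a) / (1 - A)) \<le> 1"
        using a(1) AC(1) assms(1) by (auto simp: admissible_roots_iff)
      have "linear_fractional_self_map (root_map A C a)"
        using linear_fractional_self_map_fixing_0I[OF a'] by (simp add: root_map_def[abs_def])
      then have "linear_fractional_self_map (involution_conjugate p (root_map A C a))"
        by (rule linear_fractional_self_map_conjugate[OF p(1)])
      then have "linear_fractional_self_map f"
        using linear_fractional_self_map_cong[of f "involution_conjugate p (root_map A C a)"] a(2)
        by simp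
      moreover have "f p = p"
        using a(2) p(1) by (simp add: root_map_def)
      then have "elliptic f"
        by (rule elliptic_iterative_root[OF p(1) ell f])
      moreover have "b = a" if b: "b \<in> admissible_roots n A C"
        "\<forall>z\<in>unit_disk. f z = involution_conjugate p (root_map A C b) z" for b
      proof (rule inj_onD[OF inj _ b(1) a(1)])
        show "?F b = ?F a"
          by (rule restrict_ext) (use b(2) f_eq in metis)
      qed
      ultimately show "linear_fractional_self_map f \<and> elliptic f \<and>
        (\<exists>!a. a \<in> admissible_roots n A C \<and>
          (\<forall>z\<in>unit_disk. f z = involution_conjugate p (root_map A C a) z))"
        using a(1) f_eq by blast
    qed
  qed

  have automorphism: "card (iterative_roots n \<phi>) = n" if aut: "disk_automorphism \<phi>"
  proof -
    obtain A where A: "cmod A = 1"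
        "\<And>z. z \<in> unit_disk \<Longrightarrow> involution_conjugate p \<phi> z = A * z"
      using automorphism_conjugate_rotation[OF p(1) aut p(2)] by blast
    have A0: "A \<noteq> 0"
      using A(1) by auto
    have "linear_fractional_self_map (involution_conjugate p \<phi>)"
      using linear_fractional_self_map_cong[of "involution_conjugate p \<phi>", OF A(2)]
        linear_fractional_self_map_fixing_0I[OF A0, of 0] A(1) by simp
    then have "linear_fractional_self_map (involution_conjugate p (involution_conjugate p \<phi>))"
      by (rule linear_fractional_self_map_conjugate[OF p(1)])
    then have "linear_fractional_self_map \<phi>"
      using linear_fractional_self_map_cong[of "involution_conjugate p (involution_conjugate p \<phi>)" \<phi>,
        OF conjugate_conjugate[OF p(1) self]] by blast
    then have "card (iterative_roots n \<phi>) = card (admissible_roots n A 0)"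
      using count[of A 0] A(2) by simp
    then show ?thesis
      using card_nth_roots[OF A0 assms(1)] admissible_roots_rotation[OF A(1) assms(1)] by simp
  qed

  show ?thesis
  proof (intro conjI impI allI)
    assume lf: "linear_fractional_self_map \<phi>"
    show "\<exists>A C. (\<forall>z\<in>unit_disk. involution_conjugate p \<phi> z = A * z / (C * z + 1)) \<and>
        cmod A + cmod C \<le> 1 \<and> A \<noteq> 1"
      using elliptic_normal_form[OF assms(2) lf] by metis
  qed (use count describe automorphism in blast)+
qed

end
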